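(* Let $\mathrm{Spin}(m)$ be the multiplicative group of all products $\prod_{i=1}^{2n}\underline{x}_i$ ($n\in\mathbb{N}$) of an even number of unit vectors $\underline{x}_i\in S^{m-1}\subset\mathbb{R}^1_m$. For $a\in\mathrm{Spin}(m)$ let $\chi(a):\mathbb{R}^1_m\to\mathbb{R}^1_m$, $\chi(a)(\underline{x})=a\,\underline{x}\,(\widetilde{a})^{-1}$. Then $\mathrm{Spin}(m)$ is a double cover of $\mathrm{SO}(m)$ via $\chi$; that is, $\chi$ is a surjective group homomorphism from $\mathrm{Spin}(m)$ onto the special orthogonal group $\mathrm{SO}(m)$ of $\mathbb{R}^1_m$, and it is two-to-one, the elements $a$ and $-a$ having the same image.
   Context: Let $\mathbb{C}_{2m,0}$ be the complex Clifford algebra generated by $\mathbf{e}_j^{\pm}$, $j=1,\dots,m$, with $\{\mathbf{e}_j^+,\mathbf{e}_k^+\}=\{\mathbf{e}_j^-,\mathbf{e}_k^-\}=0$, $\{\mathbf{e}_j^+,\mathbf{e}_k^-\}=\delta_{jk}$ (where $\{a,b\}=ab+ba$), and $e_j=\mathbf{e}_j^++\mathbf{e}_j^-$. $R_1,\dots,R_m$ are right $\mathbb{C}_{2m,0}$-linear operators on $\mathbb{C}_{2m,0}$-valued functions on $\mathbb{Z}^m$ satisfying $\{R_j,R_k\}=2\delta_{jk}$ and $R_j[c]=e_jc$ for constants $c\in\mathbb{C}_{2m,0}$ (in particular $R_j[1]=e_j$). Hence the products $R_A=R_{a_1}\cdots R_{a_k}$ ($A=\{a_1<\dots<a_k\}\subseteq\{1,\dots,m\}$)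 are linearly independent, and the $R_j$ generate (over $\mathbb{R}$) a real Clifford algebra of signature $(m,0)$. $\mathbb{R}^1_m=\{\underline{\omega}=\sum_{j=1}^m\omega_jR_j:\ \omega_j\in\mathbb{R}\}$ with inner product $\langle\underline{a},\underline{b}\rangle=\frac12(\underline{a}\,\underline{b}+\underline{b}\,\underline{a})=\sum_j a_jb_j$ and norm $|\underline{\omega}|^2=\sum_j\omega_j^2=\underline{\omega}^2$. $S^{m-1}=\{\underline{\omega}\in\mathbb{R}^1_m:\underline{\omega}^2=1\}$. The main involution $a\mapsto\widetilde{a}$ is the (real-linear) algebra automorphism of the algebra generated by the $R_j$ with $\widetilde{R_j}=-R_j$. $\mathrm{SO}(m)$ is the group of orientation-preserving linear isometries of $\mathbb{R}^1_m\cong\mathbb{R}^m$. *)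

theory Defs
  imports "HOL-Analysis.Analysis" "HOL-Algebra.Bij"
begin

class complex_algebra_1 = real_algebra_1 +
  fixes scaleC :: "complex \<Rightarrow> 'a \<Rightarrow> 'a"
  assumes scaleC_add_right: "scaleC a (x + y) = scaleC a x + scaleC a y"
    and scaleC_add_left: "scaleC (a + b) x = scaleC a x + scaleC b x"
    and scaleC_scaleC: "scaleC a (scaleC b x) = scaleC (a * b) x"
    and scaleC_one: "scaleC 1 x = x"
    and scaleR_scaleC: "scaleR r x = scaleC (complex_of_real r) x"
    and mult_scaleC_left: "scaleC a x * y = scaleC a (x * y)"
    and mult_scaleC_right: "x * scaleC a y = scaleC a (x * y)"

inductive_set generated_algebra :: "('k \<Rightarrow> 'a \<Rightarrow> 'a) \<Rightarrow> 'a set \<Rightarrow> 'a::ring_1 set"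
  for scale :: "'k \<Rightarrow> 'a \<Rightarrow> 'a" and S :: "'a set" where
  gen: "x \<in> S \<Longrightarrow> x \<in> generated_algebra scale S"
| one: "1 \<in> generated_algebra scale S"
| scale: "x \<in> generated_algebra scale S \<Longrightarrow> scale c x \<in> generated_algebra scale S"
| add: "x \<in> generated_algebra scale S \<Longrightarrow> y \<in> generated_algebra scale S
    \<Longrightarrow> x + y \<in> generated_algebra scale S"
| mult: "x \<in> generated_algebra scale S \<Longrightarrow> y \<in> generated_algebra scale S
    \<Longrightarrow> x * y \<in> generated_algebra scale S"

text \<open>The type \<open>'c\<close> is the complex Clifford algebra on the generators \<open>ep j\<close>, \<open>em j\<close>, with
  \<open>m\<close> the cardinality of the index type.  The relations and generation bound the
  dimension by \<open>2^(2m)\<close>; equality says that no further relations hold.\<close>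

definition complex_clifford_algebra ::
    "('m::finite \<Rightarrow> 'c::complex_algebra_1) \<Rightarrow> ('m \<Rightarrow> 'c) \<Rightarrow> bool" where
  "complex_clifford_algebra ep em \<longleftrightarrow>
     (\<forall>j k. ep j * ep k + ep k * ep j = 0) \<and>
     (\<forall>j k. em j * em k + em k * em j = 0) \<and>
     (\<forall>j k. ep j * em k + em k * ep j = (if j = k then 1 else 0)) \<and>
     generated_algebra scaleC (range ep \<union> range em) = UNIV \<and>
     vector_space.dim (scaleC :: complex \<Rightarrow> 'c \<Rightarrow> 'c) UNIV = 2 ^ (2 * CARD('m))"

text \<open>Right linear operators on \<open>'c\<close>-valued functions, as a ring under composition.
  The scalars of \<open>'c\<close> being central, real (and complex) linearity is a
  consequence of right linearity.\<close>

typedef (overloaded) ('x, 'c::real_algebra_1) rop =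
  "{T :: ('x \<Rightarrow> 'c) \<Rightarrow> 'x \<Rightarrow> 'c.
     (\<forall>f g. T (\<lambda>x. f x + g x) = (\<lambda>x. T f x + T g x)) \<and>
     (\<forall>f c. T (\<lambda>x. f x * c) = (\<lambda>x. T f x * c))}"
  morphisms apply_rop Abs_rop
  by (rule exI[of _ "\<lambda>f. f"]) simp

setup_lifting type_definition_rop

instantiation rop :: (type, real_algebra_1) real_algebra_1
begin

lift_definition zero_rop :: "('a, 'b) rop" is "\<lambda>f x. 0" by simp
lift_definition one_rop :: "('a, 'b) rop" is "\<lambda>f. f" by simp
lift_definition plus_rop :: "('a, 'b) rop \<Rightarrow> ('a, 'b) rop \<Rightarrow> ('a, 'b) rop"
  is "\<lambda>S T f x. S f x + T f x" by (simp add: algebra_simps)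
lift_definition minus_rop :: "('a, 'b) rop \<Rightarrow> ('a, 'b) rop \<Rightarrow> ('a, 'b) rop"
  is "\<lambda>S T f x. S f x - T f x" by (simp add: algebra_simps)
lift_definition uminus_rop :: "('a, 'b) rop \<Rightarrow> ('a, 'b) rop"
  is "\<lambda>T f x. - T f x" by simp
lift_definition times_rop :: "('a, 'b) rop \<Rightarrow> ('a, 'b) rop \<Rightarrow> ('a, 'b) rop"
  is "\<lambda>S T f. S (T f)" by simp
lift_definition scaleR_rop :: "real \<Rightarrow> ('a, 'b) rop \<Rightarrow> ('a, 'b) rop"
  is "\<lambda>r T f x. r *\<^sub>R T f x" by (simp add: algebra_simps)

lemma right_linear_scaleR:
  fixes T :: "('x \<Rightarrow> 'c::real_algebra_1) \<Rightarrow> 'x \<Rightarrow> 'c"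
  assumes "\<forall>f c. T (\<lambda>x. f x * c) = (\<lambda>x. T f x * c)"
  shows "T (\<lambda>x. r *\<^sub>R f x) = (\<lambda>x. r *\<^sub>R T f x)"
  using assms[rule_format, of f "r *\<^sub>R 1"] by simp

instance
proof
  fix a b c :: "('a, 'b) rop" and r s :: real
  show "a + b + c = a + (b + c)" by transfer (simp add: algebra_simps)
  show "a + b = b + a" by transfer (simp add: algebra_simps)
  show "0 + a = a" by transfer simp
  show "- a + a = 0" by transfer simp
  show "a - b = a + - b" by transfer simp
  show "a * b * c = a * (b * c)" by transfer simp
  show "1 * a = a" by transfer simp
  show "a * 1 = a" by transfer simp
  show "(a + b) * c = a * c + b * c" by transfer simp
  show "a * (b + c) = a * b + a * c" by transfer simp
  show "(0::('a, 'b) rop) \<noteq> 1"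
    by transfer (metis zero_neq_one)
  show "r *\<^sub>R (a + b) = r *\<^sub>R a + r *\<^sub>R b" by transfer (simp add: algebra_simps)
  show "(r + s) *\<^sub>R a = r *\<^sub>R a + s *\<^sub>R a" by transfer (simp add: algebra_simps)
  show "r *\<^sub>R s *\<^sub>R a = (r * s) *\<^sub>R a" by transfer simp
  show "1 *\<^sub>R a = a" by transfer simp
  show "r *\<^sub>R a * b = r *\<^sub>R (a * b)" by transfer simp
  show "a * r *\<^sub>R b = r *\<^sub>R (a * b)" by transfer (auto simp: right_linear_scaleR)
qed

end

definition vec_of :: "('m::finite \<Rightarrow> 'a::real_algebra_1) \<Rightarrow> real^'m \<Rightarrow> 'a" where
  "vec_of R w = (\<Sum>j\<in>UNIV. (w $ j) *\<^sub>R R j)"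

definition vector_part :: "('m::finite \<Rightarrow> 'a::real_algebra_1) \<Rightarrow> 'a set" where
  "vector_part R = range (vec_of R)"

definition unit_vectors :: "('m::finite \<Rightarrow> 'a::real_algebra_1) \<Rightarrow> 'a set" where
  "unit_vectors R = {x \<in> vector_part R. x\<^sup>2 = 1}"

definition is_main_involution ::
    "('m::finite \<Rightarrow> 'a::real_algebra_1) \<Rightarrow> ('a \<Rightarrow> 'a) \<Rightarrow> bool" where
  "is_main_involution R \<phi> \<longleftrightarrow>
     (let A = generated_algebra scaleR (range R) in
       \<phi> \<in> extensional A \<and> bij_betw \<phi> A A \<and> \<phi> 1 = 1 \<and>
       (\<forall>x\<in>A. \<forall>y\<in>A. \<phi> (x + y) = \<phi> x + \<phi> y \<and> \<phi> (x * y) = \<phi> x * \<phi> y) \<and>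
       (\<forall>c. \<forall>x\<in>A. \<phi> (c *\<^sub>R x) = c *\<^sub>R \<phi> x) \<and>
       (\<forall>j. \<phi> (R j) = - R j))"

definition main_involution :: "('m::finite \<Rightarrow> 'a::real_algebra_1) \<Rightarrow> 'a \<Rightarrow> 'a" where
  "main_involution R = (THE \<phi>. is_main_involution R \<phi>)"

definition mult_monoid :: "'a::monoid_mult monoid" where
  "mult_monoid = \<lparr>carrier = UNIV, mult = (*), one = 1\<rparr>"

definition Spin :: "('m::finite \<Rightarrow> 'a::real_algebra_1) \<Rightarrow> 'a monoid" where
  "Spin R = mult_monoid
     \<lparr>carrier := {prod_list xs |xs. set xs \<subseteq> unit_vectors R \<and> even (length xs)}\<rparr>"

text \<open>Linear isometries of \<open>vector_part R\<close> are those of \<open>real^'m\<close>, transported along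
  \<open>vec_of R\<close>; this makes sense because the \<open>R j\<close> are linearly independent in the situation of
  interest.\<close>

definition SO :: "('m::finite \<Rightarrow> 'a::real_algebra_1) \<Rightarrow> ('a \<Rightarrow> 'a) monoid" where
  "SO R = (BijGroup (vector_part R))
     \<lparr>carrier := {T \<in> Bij (vector_part R). \<exists>f :: real^'m \<Rightarrow> real^'m.
        orthogonal_transformation f \<and> det (matrix f) > 0 \<and>
        (\<forall>w. T (vec_of R w) = vec_of R (f w))}\<rparr>"

definition chi :: "('m::finite \<Rightarrow> 'a::real_algebra_1) \<Rightarrow> 'a \<Rightarrow> 'a \<Rightarrow> 'a" where
  "chi R a = (\<lambda>x\<in>vector_part R. a * x * inv\<^bsub>mult_monoid\<^esub> (main_involution R a))"

end

theory Submission
  imports Defs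
begin

text \<open>Conjugation by a product of unit vectors acts on \<^term>\<open>vector_part R\<close> as the composition of the
  corresponding reflections, up to the sign given by the parity of their number; surjectivity is
  therefore the theorem of Cartan and Dieudonne together with a determinant count. An even element in
  the kernel commutes with all generators, hence is a real scalar, and it is \<open>1\<close> or \<open>- 1\<close> because
  unit vectors act by isometries of an invariant bilinear form.

  The main involution exists because even and odd elements intersect trivially. To see this, let the
  operators act on the constant functions, where \<open>R j\<close> becomes multiplication by
  \<open>e j = ep j + em j\<close>: the elements \<open>f j = ep j - em j\<close> anticommute with all \<open>e k\<close>, so conjugation by
  \<open>e j * f j\<close> negates \<open>e j\<close> and fixes the other \<open>e k\<close>.\<close>

section \<open>Reflections and orthogonal transformations of \<open>real^'m\<close>\<close>

definition reflection :: "real^'m \<Rightarrow> real^'m \<Rightarrow> real^'m" where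
  "reflection n x = x - (2 * (n \<bullet> x)) *\<^sub>R n"

lemma orthogonal_transformation_reflection:
  assumes "n \<bullet> n = 1"
  shows "orthogonal_transformation (reflection n)"
proof -
  have "linear (reflection n)"
    by (rule linearI) (simp_all add: reflection_def inner_add_right algebra_simps)
  moreover have "reflection n v \<bullet> reflection n w = v \<bullet> w" for v w
    using assms by (simp add: reflection_def inner_diff_left inner_diff_right inner_commute algebra_simps)
  ultimately show ?thesis by (simp add: orthogonal_transformation_def)
qed

lemma reflection_reflection: "n \<bullet> n = 1 \<Longrightarrow> reflection n (reflection n x) = x"
  by (simp add: reflection_def inner_diff_right scaleR_left_distrib algebra_simps)

text \<open>An orthogonal \<open>g\<close> carrying a basis vector to \<open>n\<close> conjugates
  the reflection along that basis vector into the one along \<open>n\<close>. Conjugation keeps the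
  determinant, and the first reflection is diagonal with a single entry -1.\<close>

lemma det_reflection:
  fixes n :: "real^'m"
  assumes "n \<bullet> n = 1"
  shows "det (matrix (reflection n)) = -1"
proof -
  fix k :: 'm
  have norm: "norm (axis k 1 :: real^'m) = norm n"
    using assms by (simp add: norm_eq_sqrt_inner)
  obtain g :: "real^'m \<Rightarrow> real^'m" where g: "orthogonal_transformation g" "g (axis k 1) = n"
    by (rule orthogonal_transformation_exists[OF norm])
  have "linear (reflection m)" if "m \<bullet> m = 1" for m :: "real^'m"
    using that by (intro orthogonal_transformation_linear orthogonal_transformation_reflection)
  then have lin: "linear g" "linear (reflection n)" "linear (reflection (axis k 1 :: real^'m))"
    using g(1) assms by (simp_all add: orthogonal_transformation_linear inner_axis_axis)
  have comp: "reflection n \<circ> g = g \<circ> reflection (axis k 1)"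
  proof
    fix x
    have "n \<bullet> g x = axis k 1 \<bullet> x"
      using g by (auto simp: orthogonal_transformation_def)
    then show "(reflection n \<circ> g) x = (g \<circ> reflection (axis k 1)) x"
      by (simp add: reflection_def linear_diff[OF lin(1)] linear_scale[OF lin(1)] g(2))
  qed
  have "det (matrix (reflection n)) * det (matrix g) = det (matrix g) * det (matrix (reflection (axis k 1 :: real^'m)))"
    using arg_cong[OF comp, of "\<lambda>f. det (matrix f)"]
    unfolding matrix_compose[OF lin(1,2)] matrix_compose[OF lin(3,1)] det_mul .
  moreover have "det (matrix g) \<noteq> 0"
    using orthogonal_transformation_det[OF g(1)] by auto
  moreover have "det (matrix (reflection (axis k 1 :: real^'m))) = -1"
  proof -
    have entry: "matrix (reflection (axis k 1 :: real^'m)) $ i $ j = (if i = j then if i = k then -1 else 1 else 0)" for i j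
      by (simp add: matrix_def reflection_def inner_axis_axis) (auto simp: axis_def)
    then have "det (matrix (reflection (axis k 1 :: real^'m))) = (\<Prod>i\<in>UNIV. if i = k then -1 else 1)"
      by (subst det_diagonal) auto
    also have "\<dots> = -1" by simp
    finally show ?thesis .
  qed
  ultimately show ?thesis by (metis mult_cancel_right mult_minus1 mult_minus1_right)
qed

lemma orthogonal_transformation_foldr_reflection:
  "\<forall>n\<in>set ns. n \<bullet> n = 1 \<Longrightarrow> orthogonal_transformation (foldr reflection ns)"
proof (induction ns)
  case (Cons n ns)
  then have "orthogonal_transformation (reflection n \<circ> foldr reflection ns)"
    by (intro orthogonal_transformation_compose orthogonal_transformation_reflection) simp_all
  then show ?case by (simp add: comp_def)
qed (simp add: id_def)

lemma det_foldr_reflection: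
  assumes "\<forall>n\<in>set ns. n \<bullet> n = 1"
  shows "det (matrix (foldr reflection ns)) = (-1) ^ length ns"
  using assms
proof (induction ns)
  case Nil
  then show ?case by (simp add: matrix_id_mat_1[unfolded id_def] id_def)
next
  case (Cons n ns)
  then have "linear (foldr reflection ns)" "linear (reflection n)"
    by (auto intro!: orthogonal_transformation_linear orthogonal_transformation_reflection
        orthogonal_transformation_foldr_reflection)
  moreover have "foldr reflection (n # ns) = reflection n \<circ> foldr reflection ns" by auto
  moreover have "det (matrix (reflection n)) = -1" using Cons.prems by (simp add: det_reflection)
  ultimately show ?case using Cons by (simp add: matrix_compose det_mul del: foldr.simps comp_apply)
qed

text \<open>Cartan--Dieudonne: if \<open>f\<close> fixes some of the basis vectors but moves \<open>axis k 1\<close>, the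
  reflection exchanging \<open>axis k 1\<close> and its image fixes the same basis vectors.\<close>

lemma orthogonal_transformation_eq_foldr_reflection:
  fixes f :: "real^'m \<Rightarrow> real^'m"
  assumes "orthogonal_transformation f"
  obtains ns where "\<forall>n\<in>set ns. n \<bullet> n = 1" "f = foldr reflection ns"
proof -
  \<comment> \<open>\<open>J\<close> holds the indices of the basis vectors that \<open>f\<close> is
    still allowed to move; the theorem is the case of all indices.\<close>
  have "finite J \<Longrightarrow> orthogonal_transformation f \<Longrightarrow> \<forall>k. k \<notin> J \<longrightarrow> f (axis k 1) = axis k 1
      \<Longrightarrow> \<exists>ns. (\<forall>n\<in>set ns. n \<bullet> n = 1) \<and> f = foldr reflection ns"
    for J :: "'m set" and f :: "real^'m \<Rightarrow> real^'m"
  proof (induction J arbitrary: f rule: finite_induct)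
    case empty
    have "f = id"
    proof (rule linear_eq_stdbasis)
      show "linear f" using empty by (simp add: orthogonal_transformation_linear)
      show "linear (id :: real^'m \<Rightarrow> real^'m)" by (rule linear_id)
      show "f b = id b" if "b \<in> Basis" for b
        using that empty by (auto simp: Basis_vec_def)
    qed
    then show ?case by (intro exI[of _ "[]"]) auto
  next
    case (insert k J)
    show ?case
    proof (cases "f (axis k 1) = axis k 1")
      case True
      with insert show ?thesis by (metis insertE)
    next
      case False
      define d where "d = f (axis k 1) - axis k 1"
      define n where "n = d /\<^sub>R norm d"
      have d: "d \<noteq> 0" using False by (simp add: d_def)
      then have n: "n \<bullet> n = 1"
        by (simp add: n_def inner_divide_left flip: power2_norm_eq_inner)
      have isom: "f x \<bullet> f y = x \<bullet> y" for x y
        using insert.prems(1) by (simp add: orthogonal_transformation_def)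
      have reflection_d: "reflection n x = x - (2 * (d \<bullet> x) / (d \<bullet> d)) *\<^sub>R d" for x
        using d by (simp add: reflection_def n_def dot_square_norm power2_eq_square divide_simps)
      \<comment> \<open>Since \<open>f\<close> preserves length, \<open>d\<close> pairs with
        \<open>f (axis k 1)\<close> to exactly half of its own square. The reflection therefore
        subtracts \<open>d\<close> once, which gives \<open>axis k 1\<close>.\<close>
      have "d \<bullet> d = 2 * (d \<bullet> f (axis k 1))"
        using isom[of "axis k 1" "axis k 1"]
        by (simp add: d_def inner_diff_left inner_diff_right inner_axis_axis inner_commute)
      then have one: "2 * (d \<bullet> f (axis k 1)) / (d \<bullet> d) = 1"
        using d by (metis divide_self inner_eq_zero_iff)
      have swap: "reflection n (f (axis k 1)) = axis k 1"
        unfolding reflection_d one by (simp add: d_def)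
      have fix': "reflection n (f (axis l 1)) = axis l 1" if "l \<notin> insert k J" for l
      proof -
        have l: "f (axis l 1) = axis l 1" using insert.prems(2) that by blast
        \<comment> \<open>\<open>f\<close> fixes \<open>axis l 1\<close> and preserves inner
          products, so \<open>axis k 1\<close> and its image have the same inner product with
          it.\<close>
        have "d \<bullet> axis l 1 = 0"
          using isom[of "axis k 1" "axis l 1"] by (simp add: l d_def inner_diff_left)
        then show ?thesis by (simp add: l reflection_d)
      qed
      have "orthogonal_transformation (reflection n \<circ> f)"
        using insert.prems(1) n by (intro orthogonal_transformation_compose orthogonal_transformation_reflection)
      moreover have "\<forall>l. l \<notin> J \<longrightarrow> (reflection n \<circ> f) (axis l 1) = axis l 1"
        using swap fix' by (metis comp_apply insertE)
      ultimately obtain ns where ns: "\<forall>n\<in>set ns. n \<bullet> n = 1" "reflection n \<circ> f = foldr reflection ns"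
        using insert.IH by blast
      have "f x = foldr reflection (n # ns) x" for x
        using reflection_reflection[OF n, of "f x"] by (simp flip: ns(2))
      then have "f = foldr reflection (n # ns)" by blast
      then show ?thesis using ns(1) n by (intro exI[of _ "n # ns"]) auto
    qed
  qed
  from this[of UNIV f] assms obtain ns where "\<forall>n\<in>set ns. n \<bullet> n = 1" "f = foldr reflection ns"
    by auto
  then show thesis by (rule that)
qed

lemma inv_mult_monoid:
  fixes a b :: "'a::monoid_mult"
  assumes ab: "a * b = 1" and ba: "b * a = 1"
  shows "inv\<^bsub>mult_monoid\<^esub> a = b"
proof -
  have "c = b" if "a * c = 1" for c
  proof -
    have "c = (b * a) * c" by (simp only: ba mult_1_left)
    also have "\<dots> = b" by (simp only: mult.assoc that mult_1_right)
    finally show ?thesis .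
  qed
  then have "(THE c. a * c = 1 \<and> c * a = 1) = b"
    using ab ba by (intro the_equality) blast+
  then show ?thesis by (simp add: m_inv_def mult_monoid_def)
qed

section \<open>Clifford generators, words in them, and parity\<close>

locale clifford_generators =
  fixes R :: "'m::finite \<Rightarrow> 'a::real_algebra_1"
  assumes anticomm: "R j * R k + R k * R j = (if j = k then 2 else 0)"
begin

lemma square [simp]: "R j * R j = 1"
proof -
  have "(2::real) *\<^sub>R (R j * R j) = 2 *\<^sub>R 1"
    using anticomm[of j j] by (simp add: scaleR_2)
  then show ?thesis by simp
qed

lemma square_left [simp]: "R j * (R j * x) = x"
  by (simp flip: mult.assoc)

lemma swap: "j \<noteq> k \<Longrightarrow> R j * R k = - (R k * R j)"
  using anticomm[of j k] by (simp add: eq_neg_iff_add_eq_0)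

lemma swap_left: "j \<noteq> k \<Longrightarrow> R j * (R k * x) = - (R k * (R j * x))"
  by (metis swap mult.assoc mult_minus_left)

abbreviation word :: "'m list \<Rightarrow> 'a" where
  "word js \<equiv> prod_list (map R js)"

text \<open>Words need be neither sorted nor free of repetitions, so multiplication is
  concatenation. Nothing is said about independence of words: the spans for \<open>True\<close> and
  \<open>False\<close> might still overlap.\<close>

definition wspan :: "'m set \<Rightarrow> bool \<Rightarrow> 'a set" where
  "wspan J p = span {word js | js. set js \<subseteq> J \<and> even (length js) = p}"

lemma word_in_wspan: "set js \<subseteq> J \<Longrightarrow> even (length js) = p \<Longrightarrow> word js \<in> wspan J p"
  unfolding wspan_def by (rule span_base) blast

lemma wspan_add: "x \<in> wspan J p \<Longrightarrow> y \<in> wspan J p \<Longrightarrow> x + y \<in> wspan J p"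
  and wspan_scale: "x \<in> wspan J p \<Longrightarrow> c *\<^sub>R x \<in> wspan J p"
  and wspan_zero: "0 \<in> wspan J p"
  and wspan_neg: "x \<in> wspan J p \<Longrightarrow> - x \<in> wspan J p"
  and wspan_diff: "x \<in> wspan J p \<Longrightarrow> y \<in> wspan J p \<Longrightarrow> x - y \<in> wspan J p"
  unfolding wspan_def by (auto intro: span_add span_scale span_zero span_neg span_diff)

lemma wspan_induct [consumes 1, case_names zero step]:
  assumes "x \<in> wspan J p" "Q 0"
    and "\<And>c js y. set js \<subseteq> J \<Longrightarrow> even (length js) = p \<Longrightarrow> y \<in> wspan J p \<Longrightarrow> Q y
      \<Longrightarrow> Q (c *\<^sub>R word js + y)"
  shows "Q x"
proof -
  have "x \<in> wspan J p \<and> Q x"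
    using assms(1)[unfolded wspan_def]
  proof (induction rule: span_induct_alt)
    case base
    then show ?case using assms(2) wspan_zero by blast
  next
    case (step c x y)
    then show ?case
      using assms(3) by (auto intro!: wspan_add wspan_scale word_in_wspan)
  qed
  then show ?thesis ..
qed

lemma wspan_one: "1 \<in> wspan J True"
  using word_in_wspan[of "[]" J True] by simp

lemma generator_in_wspan: "j \<in> J \<Longrightarrow> R j \<in> wspan J False"
  using word_in_wspan[of "[j]" J False] by simp

text \<open>A sum of two lengths is even exactly when both have the same parity, hence
  \<open>p = q\<close>.\<close>

lemma wspan_mult:
  assumes "x \<in> wspan J p" "y \<in> wspan J q"
  shows "x * y \<in> wspan J (p = q)"
  using assms(1)
proof (induction rule: wspan_induct)
  case zero
  then show ?case by (simp add: wspan_zero)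
next
  case (step c js x)
  have "word js * y \<in> wspan J (p = q)"
    using assms(2)
  proof (induction rule: wspan_induct)
    case zero
    then show ?case by (simp add: wspan_zero)
  next
    case (step d ks y)
    have "word js * word ks \<in> wspan J (p = q)"
      using word_in_wspan[of "js @ ks" J "p = q"] step \<open>set js \<subseteq> J\<close> \<open>even (length js) = p\<close> by auto
    with step show ?case
      by (auto simp: distrib_left intro!: wspan_add wspan_scale)
  qed
  with step show ?case by (auto simp: distrib_right intro!: wspan_add wspan_scale)
qed

lemma wspan_empty:
  assumes "x \<in> wspan {} p"
  obtains r where "x = (if p then r *\<^sub>R 1 else 0)"
proof -
  have "\<exists>r. x = (if p then r *\<^sub>R 1 else 0)"
    using assms
  proof (induction rule: wspan_induct)
    case zero
    then show ?case by (auto intro: exI[of _ 0])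
  next
    case (step c js y)
    then show ?case by (auto simp: scaleR_left_distrib[symmetric])
  qed
  then show thesis using that by blast
qed

text \<open>Each letter of a word over \<open>J\<close> differs from \<open>j\<close> and
  contributes one sign when \<open>R j\<close> passes it.\<close>

lemma generator_commute:
  assumes "x \<in> wspan J p" "j \<notin> J"
  shows "R j * x = (if p then x * R j else - (x * R j))"
  using assms(1)
proof (induction rule: wspan_induct)
  case zero
  then show ?case by simp
next
  case (step c js y)
  have "R j * word js = (if even (length js) then word js * R j else - (word js * R j))"
    using step(1)
  proof (induction js)
    case (Cons k js)
    then have "j \<noteq> k" using assms(2) by auto
    with Cons show ?case by (auto simp: swap_left mult.assoc)
  qed simp
  with step show ?case by (auto simp: distrib_left distrib_right)
qed

text \<open>All occurrences of \<open>R j\<close> are moved to the front. A further letter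
  \<open>R j\<close> exchanges the two components because it squares to 1; any other letter
  multiplies both, with a sign on the one behind \<open>R j\<close>.\<close>

lemma wspan_insert:
  assumes "x \<in> wspan (insert j J) p" "j \<notin> J"
  obtains a b where "a \<in> wspan J p" "b \<in> wspan J (\<not> p)" "x = a + R j * b"
proof -
  have "\<exists>a\<in>wspan J p. \<exists>b\<in>wspan J (\<not> p). x = a + R j * b"
    using assms(1)
  proof (induction rule: wspan_induct)
    case zero
    then show ?case by (auto intro!: bexI[of _ 0] simp: wspan_zero)
  next
    case (step c js y)
    have "\<exists>a\<in>wspan J (even (length js)). \<exists>b\<in>wspan J (odd (length js)). word js = a + R j * b"
      using step(1)
    proof (induction js)
      case Nil
      show ?case
        by (rule bexI[of _ 1], rule bexI[of _ 0]) (auto simp: wspan_zero wspan_one)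
    next
      case (Cons k js)
      then obtain a b where ab: "a \<in> wspan J (even (length js))" "b \<in> wspan J (odd (length js))"
        "word js = a + R j * b" by auto
      show ?case
      proof (cases "k = j")
        case True
        then show ?thesis
          using ab by (intro bexI[of _ b] bexI[of _ a]) (auto simp: distrib_left)
      next
        case False
        with Cons have k: "R k \<in> wspan J False" by (auto intro: generator_in_wspan)
        have "word (k # js) = R k * a + R j * - (R k * b)"
          using False ab(3) by (simp add: distrib_left swap_left[of k j])
        moreover have "R k * a \<in> wspan J (even (length (k # js)))"
          using wspan_mult[OF k ab(1)] by simp
        moreover have "- (R k * b) \<in> wspan J (odd (length (k # js)))"
          using wspan_neg[OF wspan_mult[OF k ab(2)]] by simp
        ultimately show ?thesis by blast
      qed
    qed
    then obtain a b where "a \<in> wspan J p" "b \<in> wspan J (\<not> p)" "word js = a + R j * b"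
      using step(2) by auto
    moreover obtain a' b' where "a' \<in> wspan J p" "b' \<in> wspan J (\<not> p)" "y = a' + R j * b'"
      using step by auto
    ultimately show ?case
      by (intro bexI[of _ "c *\<^sub>R a + a'"] bexI[of _ "c *\<^sub>R b + b'"])
        (auto simp: algebra_simps wspan_add wspan_scale)
  qed
  then show thesis using that by blast
qed

text \<open>Conjugation by \<open>R j\<close> fixes the part of an even element that avoids \<open>R j\<close> and negates the
  rest, so the generators can be eliminated one after the other.\<close>

lemma even_central_is_scalar:
  assumes "x \<in> wspan UNIV True" and comm: "\<And>j. R j * x = x * R j"
  obtains r where "x = r *\<^sub>R 1"
proof -
  have "finite J \<Longrightarrow> x \<in> wspan J True \<Longrightarrow> \<exists>r. x = r *\<^sub>R 1" for J
  proof (induction J rule: finite_induct)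
    case empty
    then show ?case using wspan_empty by (metis (full_types))
  next
    case (insert j J)
    obtain a b where ab: "a \<in> wspan J True" "b \<in> wspan J False" "x = a + R j * b"
      using wspan_insert[OF insert.prems insert.hyps(2)] by auto
    have "R j * a = a * R j" "R j * b = - (b * R j)"
      using generator_commute ab insert.hyps(2) by fastforce+
    then have ba: "b * R j = - (R j * b)" and aa: "R j * a = a * R j" by simp_all
    have "R j * x = a * R j + b"
      by (simp add: ab(3) distrib_left aa)
    moreover have "x * R j = a * R j - b"
      by (simp add: ab(3) distrib_right ba mult.assoc)
    ultimately have "b = - b" using comm[of j] by simp
    then have "2 *\<^sub>R b = 0" by (metis add.right_inverse scaleR_2)
    then have "b = 0" by simp
    then show ?case using ab insert.IH by simp
  qed
  then show thesis using assms(1) that finite[of "UNIV :: 'm set"] by blast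
qed

section \<open>Vectors inside the algebra\<close>

lemma vec_in_wspan: "vec_of R w \<in> wspan UNIV False"
proof -
  have "(\<Sum>j\<in>A. (w $ j) *\<^sub>R R j) \<in> wspan UNIV False" for A
    by (induction A rule: infinite_finite_induct)
      (auto intro: wspan_zero wspan_add wspan_scale generator_in_wspan)
  then show ?thesis by (simp add: vec_of_def)
qed

lemma linear_vec_of: "linear (vec_of R)"
  by (rule linearI)
    (simp_all add: vec_of_def scaleR_left_distrib sum.distrib scaleR_sum_right)

lemma vec_of_axis: "vec_of R (axis j 1) = R j"
  by (simp add: vec_of_def axis_def if_distrib[of "\<lambda>c. c *\<^sub>R _"] cong: if_cong)

lemma vec_of_anticomm:
  "vec_of R v * vec_of R w + vec_of R w * vec_of R v = (2 * (v \<bullet> w)) *\<^sub>R 1"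
proof -
  have "vec_of R v * vec_of R w + vec_of R w * vec_of R v
      = (\<Sum>j\<in>UNIV. \<Sum>k\<in>UNIV. (v $ j * w $ k) *\<^sub>R (R j * R k + R k * R j))"
    unfolding vec_of_def sum_product
    \<comment> \<open>Interchanging the sums in the second product pairs \<open>R j * R k\<close>
      with \<open>R k * R j\<close> under the same coefficient.\<close>
    by (subst (2) sum.swap) (simp add: sum.distrib scaleR_right_distrib mult.commute)
  also have "\<dots> = (\<Sum>j\<in>UNIV. (2 * (v $ j * w $ j)) *\<^sub>R 1)"
    by (simp add: anticomm if_distrib[of "\<lambda>c. _ *\<^sub>R c"] scaleR_2[of 1, simplified] mult_ac
        flip: scaleR_scaleR cong: if_cong)
  also have "\<dots> = (2 * (v \<bullet> w)) *\<^sub>R 1"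
    by (simp add: inner_vec_def sum_distrib_left flip: scaleR_sum_left)
  finally show ?thesis .
qed

lemma vec_of_square: "vec_of R v * vec_of R v = (v \<bullet> v) *\<^sub>R 1"
proof -
  have "2 *\<^sub>R (vec_of R v * vec_of R v) = 2 *\<^sub>R ((v \<bullet> v) *\<^sub>R 1)"
    using vec_of_anticomm[of v v] by (simp add: scaleR_2)
  then show ?thesis by (simp only: scaleR_cancel_left) simp
qed

text \<open>The square of a vector is its squared norm times 1, so a vector with image 0 has norm 0.
  Independence of the generators thus follows from the relations.\<close>

lemma inj_vec_of: "inj (vec_of R)"
proof (rule linear_injective_0[OF linear_vec_of, THEN iffD2], intro allI impI)
  fix v assume "vec_of R v = 0"
  then show "v = 0" using vec_of_square[of v] by simp
qed

lemma unit_vectors_eq: "unit_vectors R = vec_of R ` {n. n \<bullet> n = 1}"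
proof -
  have "(r *\<^sub>R 1 = (1::'a)) = (r = 1)" for r
    by (metis of_real_def of_real_eq_1_iff)
  then show ?thesis
    by (auto simp: unit_vectors_def vector_part_def power2_eq_square vec_of_square)
qed


section \<open>Even and odd parts of the generated algebra\<close>

lemma wspan_mono:
  assumes "x \<in> wspan J p" "J \<subseteq> K"
  shows "x \<in> wspan K p"
proof -
  have "{word js | js. set js \<subseteq> J \<and> even (length js) = p}
      \<subseteq> {word js | js. set js \<subseteq> K \<and> even (length js) = p}"
    using assms(2) by blast
  then show ?thesis using assms(1) unfolding wspan_def by (meson span_mono subsetD)
qed

text \<open>Products of parity components are again parity components, so these sums are closed
  under all algebra operations. The sum is not yet claimed to be direct.\<close>

lemma generated_algebra_eq:
  "generated_algebra scaleR (range R) = {a + b | a b. a \<in> wspan UNIV True \<and> b \<in> wspan UNIV False}"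
    (is "?G = ?S")
proof
  show "?G \<subseteq> ?S"
  proof
    fix x assume "x \<in> ?G"
    then show "x \<in> ?S"
    proof induction
      case (gen x)
      then have "x = 0 + x" "x \<in> wspan UNIV False" by (auto intro: generator_in_wspan)
      then show ?case using wspan_zero by blast
    next
      case one
      have "1 = 1 + (0::'a)" by simp
      then show ?case using wspan_zero wspan_one by blast
    next
      case (scale x c)
      then show ?case using wspan_scale by (force simp: scaleR_right_distrib)
    next
      case (add x y)
      then obtain a b c d where "x = a + b" "y = c + d"
        "a \<in> wspan UNIV True" "c \<in> wspan UNIV True" "b \<in> wspan UNIV False" "d \<in> wspan UNIV False"
        by blast
      moreover from this have "x + y = (a + c) + (b + d)" by simp
      ultimately show ?case using wspan_add by blast
    next
      case (mult x y)
      then obtain a b c d where xy: "x = a + b" "y = c + d"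
        and mem: "a \<in> wspan UNIV True" "c \<in> wspan UNIV True" "b \<in> wspan UNIV False" "d \<in> wspan UNIV False"
        by blast
      have "x * y = (a * c + b * d) + (a * d + b * c)"
        by (simp add: xy algebra_simps)
      moreover have "a * c + b * d \<in> wspan UNIV True" "a * d + b * c \<in> wspan UNIV False"
        using wspan_mult[OF mem(1,2)] wspan_mult[OF mem(3,4)] wspan_mult[OF mem(1,4)] wspan_mult[OF mem(3,2)]
        by (auto intro: wspan_add)
      ultimately show ?case by blast
    qed
  qed
  have word: "word js \<in> ?G" for js
    by (induction js) (auto intro: generated_algebra.intros)
  have "x \<in> ?G" if "x \<in> wspan UNIV p" for x p
    using that
  proof (induction rule: wspan_induct)
    case zero
    \<comment> \<open>The inductive definition has no rule for zero; it arises as a scalar multiple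
      of 1.\<close>
    have "0 *\<^sub>R 1 \<in> ?G" by (intro generated_algebra.scale generated_algebra.one)
    then show ?case by simp
  next
    case (step c js y)
    then show ?case by (intro generated_algebra.add generated_algebra.scale word) auto
  qed
  then show "?S \<subseteq> ?G" by (auto intro: generated_algebra.add)
qed

text \<open>The hypothesis asks for an inner automorphism of the target that negates the image of \<open>R j\<close>
  and fixes the images of the other generators: then, as in \<open>even_central_is_scalar\<close>, generators
  can be split off one at a time from a vanishing linear combination.\<close>

lemma parity_direct_if_hom:
  fixes \<rho> :: "'a \<Rightarrow> 'b::real_algebra_1" and u :: "'m \<Rightarrow> 'b"
  assumes add: "\<And>x y. \<rho> (x + y) = \<rho> x + \<rho> y"
    and scale: "\<And>c x. \<rho> (c *\<^sub>R x) = c *\<^sub>R \<rho> x"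
    and one: "\<rho> 1 = 1"
    and mult: "\<And>j x p. x \<in> wspan UNIV p \<Longrightarrow> \<rho> (R j * x) = \<rho> (R j) * \<rho> x"
    and u_square: "\<And>j. u j * u j = 1"
    and u_same: "\<And>j. u j * \<rho> (R j) = - (\<rho> (R j) * u j)"
    and u_other: "\<And>j k. j \<noteq> k \<Longrightarrow> u j * \<rho> (R k) = \<rho> (R k) * u j"
    and "a \<in> wspan UNIV True" "b \<in> wspan UNIV False" "a + b = 0"
  shows "a = 0"
proof -
  have zero: "\<rho> 0 = 0" using scale[of 0 0] by simp
  have u_comm: "u j * \<rho> x = \<rho> x * u j" if "x \<in> wspan J p" "j \<notin> J" for x j J p
    using that(1)
  proof (induction rule: wspan_induct)
    case zero
    then show ?case by (simp add: \<open>\<rho> 0 = 0\<close>)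
  next
    case (step c js y)
    have "u j * \<rho> (word js) = \<rho> (word js) * u j"
      using step(1)
    proof (induction js)
      case Nil
      then show ?case by (simp add: one)
    next
      case (Cons k js)
      then have "j \<noteq> k" using that(2) by auto
      moreover have "\<rho> (word (k # js)) = \<rho> (R k) * \<rho> (word js)"
        using mult[OF word_in_wspan[OF subset_UNIV refl]] by simp
      ultimately show ?case
        using Cons u_other[of j k] by (simp add: mult.assoc) (metis mult.assoc)
    qed
    with step show ?case by (simp add: add scale distrib_left distrib_right)
  qed
  \<comment> \<open>Only the image of \<open>x + y\<close> is assumed to vanish. This strengthening
    lets the induction hypothesis be applied to components that are known only through their images
    under \<open>\<rho>\<close>.\<close>
  have "finite J \<Longrightarrow> x \<in> wspan J True \<Longrightarrow> y \<in> wspan J False \<Longrightarrow> \<rho> (x + y) = 0 \<Longrightarrow> x = 0 \<and> y = 0"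
    for J x y
  proof (induction J arbitrary: x y rule: finite_induct)
    case empty
    obtain r where r: "x = r *\<^sub>R 1" using wspan_empty[OF empty(1)] by auto
    moreover have y: "y = 0" using wspan_empty[OF empty(2)] by auto
    ultimately show ?case using empty(3) by (simp add: scale one)
  next
    case (insert j J)
    obtain x0 x1 where x: "x0 \<in> wspan J True" "x1 \<in> wspan J False" "x = x0 + R j * x1"
      using wspan_insert[OF insert.prems(1) insert.hyps(2)] by auto
    obtain y0 y1 where y: "y0 \<in> wspan J False" "y1 \<in> wspan J True" "y = y0 + R j * y1"
      using wspan_insert[OF insert.prems(2) insert.hyps(2)] by auto
    \<comment> \<open>\<open>s\<close> is the image of the part free of \<open>R j\<close>, and
      \<open>t\<close> that of the coefficient of \<open>R j\<close>. Each again comes from an even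
      plus an odd element over \<open>J\<close>, as the induction hypothesis requires.\<close>
    define s t where "s = \<rho> (x0 + y0)" and "t = \<rho> (y1 + x1)"
    have "\<rho> (R j * x1) = \<rho> (R j) * \<rho> x1" "\<rho> (R j * y1) = \<rho> (R j) * \<rho> y1"
      using mult wspan_mono[OF x(2) subset_UNIV] wspan_mono[OF y(2) subset_UNIV] by simp_all
    then have st: "s + \<rho> (R j) * t = 0"
      using insert.prems(3) by (simp add: s_def t_def x(3) y(3) add distrib_left ac_simps)
    have comm: "u j * s = s * u j" "u j * t = t * u j"
      using u_comm insert.hyps(2) x y by (simp_all add: s_def t_def add distrib_left distrib_right)
    have "u j * (\<rho> (R j) * t) = - (\<rho> (R j) * t * u j)"
      using comm(2) u_same[of j] by (simp flip: mult.assoc) (simp add: mult.assoc)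
    \<comment> \<open>Moving \<open>u j\<close> across keeps \<open>s\<close> and negates the other
      term. As \<open>u j\<close> is invertible, both the sum and the difference vanish, which
      leaves \<open>s = 0\<close> and then \<open>t = 0\<close>.\<close>
    then have "(s - \<rho> (R j) * t) * u j = u j * (s + \<rho> (R j) * t)"
      by (simp add: distrib_left left_diff_distrib comm(1))
    then have "(s - \<rho> (R j) * t) * u j * u j = 0" using st by simp
    then have "s - \<rho> (R j) * t = 0" by (simp add: mult.assoc u_square)
    then have "2 *\<^sub>R s = 0" using st by (simp add: scaleR_2)
    then have s: "s = 0" by simp
    then have "\<rho> (R j) * (\<rho> (R j) * t) = 0" using st by simp
    moreover have "\<rho> (R j) * \<rho> (R j) = 1"
      using mult[OF generator_in_wspan[OF UNIV_I], of j j] one by simp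
    ultimately have t: "t = 0" by (simp flip: mult.assoc)
    have "x0 = 0 \<and> y0 = 0" "y1 = 0 \<and> x1 = 0"
      using insert.IH x y s t unfolding s_def t_def by blast+
    with x y show ?case by simp
  qed
  with assms(8-10) zero show ?thesis by (metis finite)
qed

section \<open>An invariant bilinear form and scalar products of unit vectors\<close>

text \<open>A rank-one form is averaged over one generator at a time. Earlier invariance survives
  because distinct generators commute up to a sign, which cancels between the two arguments.
  Semidefiniteness, carried through the induction, keeps \<open>B 1 1\<close> positive.\<close>

lemma exists_invariant_form:
  obtains B :: "'a \<Rightarrow> 'a \<Rightarrow> real"
  where "\<And>x y. B x y = B y x" "\<And>y. linear (\<lambda>x. B x y)"
    "\<And>j x y. B (R j * x) (R j * y) = B x y" "B 1 1 > 0"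
proof -
  \<comment> \<open>1 is nonzero, so a linear functional can be prescribed on it.\<close>
  obtain L :: "'a \<Rightarrow> real" where L: "linear L" "L 1 = 1"
    using linear_independent_extend[of "{1::'a}" "\<lambda>_. 1"] by auto
  have "finite J \<Longrightarrow> \<exists>B :: 'a \<Rightarrow> 'a \<Rightarrow> real. (\<forall>x y. B x y = B y x) \<and> (\<forall>y. linear (\<lambda>x. B x y)) \<and>
      (\<forall>x. B x x \<ge> 0) \<and> (\<forall>j\<in>J. \<forall>x y. B (R j * x) (R j * y) = B x y) \<and> B 1 1 > 0" for J
  proof (induction J rule: finite_induct)
    case empty
    have "linear (\<lambda>x. L x * L y)" for y
      by (rule linearI) (simp_all add: linear_add[OF L(1)] linear_scale[OF L(1)] distrib_right)
    then show ?case
      by (intro exI[of _ "\<lambda>x y. L x * L y"]) (auto simp: L(2) mult.commute)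
  next
    case (insert j J)
    then obtain B :: "'a \<Rightarrow> 'a \<Rightarrow> real" where
      B: "\<And>x y. B x y = B y x" "\<And>y. linear (\<lambda>x. B x y)" "\<And>x. B x x \<ge> 0"
        "\<And>j x y. j \<in> J \<Longrightarrow> B (R j * x) (R j * y) = B x y" "B 1 1 > 0"
      by blast
    have neg: "B (- x) (- y) = B x y" for x y
      using linear_neg[OF B(2)] B(1) by (metis add.inverse_inverse)
    define B' where "B' x y = B x y + B (R j * x) (R j * y)" for x y
    have "B' x y = B' y x" for x y
      using B(1) by (simp add: B'_def)
    moreover have "linear (\<lambda>x. B' x y)" for y
      unfolding B'_def using linear_add[OF B(2)] linear_scale[OF B(2)]
      by (intro linearI) (simp_all add: distrib_left)
    moreover have "B' x x \<ge> 0" for x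
      using B(3) by (simp add: B'_def)
    moreover have "B' (R k * x) (R k * y) = B' x y" if "k \<in> insert j J" for k x y
    proof (cases "k = j")
      case True
      then show ?thesis by (simp add: B'_def)
    next
      case False
      with that B(4)[of k] show ?thesis
        by (simp add: B'_def swap_left[of j k] neg)
    qed
    moreover have "B' 1 1 > 0"
      using B(3)[of "R j"] B(5) by (simp add: B'_def)
    ultimately show ?case by (intro exI[of _ B']) blast
  qed
  then show thesis using that by (metis UNIV_I finite)
qed

text \<open>Multiplication by the product preserves \<open>B\<close>; evaluating at 1 compares
  \<open>B 1 1\<close> with \<open>r\<close> squared times \<open>B 1 1\<close>.\<close>

lemma scalar_product_of_unit_vectors:
  assumes "\<forall>n\<in>set ns. n \<bullet> n = 1" and r: "prod_list (map (vec_of R) ns) = r *\<^sub>R 1"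
  shows "r = 1 \<or> r = -1"
proof -
  obtain B :: "'a \<Rightarrow> 'a \<Rightarrow> real" where B: "\<And>x y. B x y = B y x" "\<And>y. linear (\<lambda>x. B x y)"
    "\<And>j x y. B (R j * x) (R j * y) = B x y" "B 1 1 > 0"
    using exists_invariant_form by blast
  have left: "B (vec_of R n * x) y = (\<Sum>j\<in>UNIV. n $ j * B (R j * x) y)" for n x y
    by (simp add: vec_of_def sum_distrib_right linear_sum[OF B(2)] linear_scale[OF B(2)])
  \<comment> \<open>Invariance under the generators does not pass to their linear combinations, but
    self-adjointness does. Invariance and \<open>R j * R j = 1\<close> give self-adjointness of
    \<open>R j\<close>, hence of every vector; for unit vectors this gives invariance back.\<close>
  have "B (R j * x) y = B x (R j * y)" for j x y
    using B(3)[of j "R j * x" y] by simp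
  then have adjoint: "B (vec_of R n * x) y = B x (vec_of R n * y)" for n x y
    using left[of n x y] left[of n y x] B(1) by (metis (no_types, lifting) sum.cong)
  have "B (prod_list (map (vec_of R) ns) * x) (prod_list (map (vec_of R) ns) * x) = B x x" for x
    using assms(1)
  proof (induction ns)
    case (Cons n ns)
    then have "B (vec_of R n * y) (vec_of R n * y) = B y y" for y
      using vec_of_square[of n] by (simp add: adjoint) (simp flip: mult.assoc)
    with Cons show ?case by (simp add: mult.assoc)
  qed simp
  from this[of 1] have "B (r *\<^sub>R 1) (r *\<^sub>R 1) = B 1 1" by (simp add: r)
  moreover have "B (r *\<^sub>R 1) (r *\<^sub>R 1) = r\<^sup>2 * B 1 1"
    using linear_scale[OF B(2)] B(1) by (metis mult.assoc power2_eq_square real_scaleR_def)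
  ultimately have "r\<^sup>2 = 1" using B(4) by simp
  then show ?thesis by (simp add: power2_eq_1_iff)
qed

end

section \<open>The grading and the main involution\<close>

text \<open>The relations alone do not make the parities independent: with one generator,
  \<open>R j = 1\<close> in the reals satisfies them, and 1 is then both even and odd.\<close>

locale graded_clifford_generators = clifford_generators R
  for R :: "'m::finite \<Rightarrow> 'a::real_algebra_1" +
  assumes parity_direct: "a \<in> wspan UNIV True \<Longrightarrow> b \<in> wspan UNIV False \<Longrightarrow> a + b = 0 \<Longrightarrow> a = 0"
begin

text \<open>The choice is harmless because \<open>parity_direct\<close> makes the splitting unique.
  Restricting to the generated algebra provides the extensionality demanded by
  \<open>is_main_involution\<close>.\<close>

definition grade_involution :: "'a \<Rightarrow> 'a" where
  "grade_involution = (\<lambda>x\<in>generated_algebra scaleR (range R).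
     SOME y. \<exists>a\<in>wspan UNIV True. \<exists>b\<in>wspan UNIV False. x = a + b \<and> y = a - b)"

lemma grade_involution_add:
  assumes "a \<in> wspan UNIV True" "b \<in> wspan UNIV False"
  shows "grade_involution (a + b) = a - b"
proof -
  have "y = a - b"
    if "c \<in> wspan UNIV True" "d \<in> wspan UNIV False" "a + b = c + d" "y = c - d" for c d y
  proof -
    have "(a - c) + (b - d) = 0" using that(3) by (simp add: algebra_simps)
    then have "a - c = 0" using parity_direct wspan_diff assms that(1,2) by blast
    with that show ?thesis by simp
  qed
  then have "(SOME y. \<exists>c\<in>wspan UNIV True. \<exists>d\<in>wspan UNIV False. a + b = c + d \<and> y = c - d) = a - b"
    using assms by (intro some_equality) blast+
  moreover have "a + b \<in> generated_algebra scaleR (range R)"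
    using assms by (auto simp: generated_algebra_eq)
  ultimately show ?thesis by (simp add: grade_involution_def)
qed

lemma grade_involution_is_main: "is_main_involution R grade_involution"
proof -
  let ?A = "generated_algebra scaleR (range R)"
  have mem: "a + b \<in> ?A" if "a \<in> wspan UNIV True" "b \<in> wspan UNIV False" for a b
    using that by (auto simp: generated_algebra_eq)
  have cases: thesis if "x \<in> ?A"
    "\<And>a b. a \<in> wspan UNIV True \<Longrightarrow> b \<in> wspan UNIV False \<Longrightarrow> x = a + b \<Longrightarrow> thesis" for x thesis
    using that by (auto simp: generated_algebra_eq)
  have twice: "grade_involution x \<in> ?A \<and> grade_involution (grade_involution x) = x" if "x \<in> ?A" for x
    using that
  proof (rule cases)
    fix a b assume *: "a \<in> wspan UNIV True" "b \<in> wspan UNIV False" "x = a + b"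
    then show ?thesis
      using mem[of a "- b"] grade_involution_add[of a "- b"] by (simp add: grade_involution_add wspan_neg)
  qed
  have plus: "grade_involution (x + y) = grade_involution x + grade_involution y"
    and times: "grade_involution (x * y) = grade_involution x * grade_involution y"
    if "x \<in> ?A" "y \<in> ?A" for x y
  proof -
    obtain a b c d where xy: "x = a + b" "y = c + d"
      and *: "a \<in> wspan UNIV True" "c \<in> wspan UNIV True" "b \<in> wspan UNIV False" "d \<in> wspan UNIV False"
      using \<open>x \<in> ?A\<close> \<open>y \<in> ?A\<close> by (metis cases)
    have "x + y = (a + c) + (b + d)" by (simp add: xy)
    then have "grade_involution (x + y) = (a + c) - (b + d)"
      using grade_involution_add * wspan_add by metis
    then show "grade_involution (x + y) = grade_involution x + grade_involution y"
      by (simp add: xy * grade_involution_add)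
    have "x * y = (a * c + b * d) + (a * d + b * c)"
      by (simp add: xy algebra_simps)
    moreover have "a * c + b * d \<in> wspan UNIV True" "a * d + b * c \<in> wspan UNIV False"
      using wspan_mult[OF *(1,2)] wspan_mult[OF *(3,4)] wspan_mult[OF *(1,4)] wspan_mult[OF *(3,2)]
      by (auto intro: wspan_add)
    ultimately have "grade_involution (x * y) = (a * c + b * d) - (a * d + b * c)"
      using grade_involution_add by metis
    also have "\<dots> = (a - b) * (c - d)"
      by (simp add: algebra_simps)
    finally show "grade_involution (x * y) = grade_involution x * grade_involution y"
      by (simp add: xy * grade_involution_add)
  qed
  have "grade_involution (c *\<^sub>R x) = c *\<^sub>R grade_involution x" if "x \<in> ?A" for c x
    using that
  proof (rule cases)
    fix a b assume *: "a \<in> wspan UNIV True" "b \<in> wspan UNIV False" "x = a + b"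
    then show ?thesis
      using grade_involution_add[of "c *\<^sub>R a" "c *\<^sub>R b"]
      by (simp add: grade_involution_add wspan_scale scaleR_right_distrib scaleR_right_diff_distrib)
  qed
  moreover have "bij_betw grade_involution ?A ?A"
    using twice by (intro bij_betwI[of _ _ _ grade_involution]) auto
  moreover have "grade_involution 1 = 1"
    using grade_involution_add[OF wspan_one wspan_zero] by simp
  moreover have "grade_involution (R j) = - R j" for j
    using grade_involution_add[OF wspan_zero generator_in_wspan[OF UNIV_I]] by simp
  moreover have "grade_involution \<in> extensional ?A"
    by (simp add: grade_involution_def)
  ultimately show ?thesis
    using plus times by (simp add: is_main_involution_def)
qed

text \<open>Two main involutions agree on the generators, hence on everything generated, and
  extensionality fixes their values elsewhere. So the definite description denotes
  \<open>grade_involution\<close>.\<close>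

lemma main_involution_eq: "main_involution R = grade_involution"
  unfolding main_involution_def
proof (rule the_equality)
  show "is_main_involution R grade_involution" by (rule grade_involution_is_main)
next
  let ?A = "generated_algebra scaleR (range R)"
  fix \<phi> assume \<phi>: "is_main_involution R \<phi>"
  show "\<phi> = grade_involution"
  proof (rule extensionalityI)
    show "\<phi> \<in> extensional ?A" "grade_involution \<in> extensional ?A"
      using \<phi> grade_involution_is_main by (simp_all add: is_main_involution_def Let_def)
    fix x assume "x \<in> ?A"
    then show "\<phi> x = grade_involution x"
      by induction (use \<phi> grade_involution_is_main in \<open>auto simp: is_main_involution_def Let_def\<close>)
  qed
qed

lemma main_involution_even: "a \<in> wspan UNIV True \<Longrightarrow> main_involution R a = a"
  using grade_involution_add[OF _ wspan_zero, of a] by (simp add: main_involution_eq)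


section \<open>The Spin group and its action on vectors\<close>

abbreviation unit_product :: "(real^'m) list \<Rightarrow> 'a" where
  "unit_product ns \<equiv> prod_list (map (vec_of R) ns)"

text \<open>Factors are replaced by their coordinate vectors, so that one list describes both the
  element and the composition of reflections it induces.\<close>

lemma carrier_Spin:
  "carrier (Spin R) = {unit_product ns | ns. (\<forall>n\<in>set ns. n \<bullet> n = 1) \<and> even (length ns)}"
proof -
  have "(set xs \<subseteq> unit_vectors R) = (\<exists>ns. xs = map (vec_of R) ns \<and> (\<forall>n\<in>set ns. n \<bullet> n = 1))" for xs
  proof -
    have "(set xs \<subseteq> unit_vectors R) = (xs \<in> lists (vec_of R ` {n. n \<bullet> n = 1}))"
      by (auto simp: unit_vectors_eq in_lists_conv_set)
    also have "\<dots> = (\<exists>ns. xs = map (vec_of R) ns \<and> (\<forall>n\<in>set ns. n \<bullet> n = 1))"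
      unfolding lists_image by (simp add: image_iff in_lists_conv_set Bex_def conj_commute)
    finally show ?thesis .
  qed
  then have "carrier (Spin R) = {prod_list xs |xs.
      (\<exists>ns. xs = map (vec_of R) ns \<and> (\<forall>n\<in>set ns. n \<bullet> n = 1)) \<and> even (length xs)}"
    by (simp add: Spin_def)
  also have "\<dots> = {unit_product ns | ns. (\<forall>n\<in>set ns. n \<bullet> n = 1) \<and> even (length ns)}"
    by auto
  finally show ?thesis .
qed

lemma unit_product_in_wspan: "unit_product ns \<in> wspan UNIV (even (length ns))"
proof (induction ns)
  case (Cons n ns)
  then show ?case using wspan_mult[OF vec_in_wspan Cons] by simp
qed (simp add: wspan_one)

lemma unit_product_rev:
  "\<forall>n\<in>set ns. n \<bullet> n = 1 \<Longrightarrow> unit_product ns * unit_product (rev ns) = 1"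
proof (induction ns)
  case (Cons n ns)
  have "unit_product (n # ns) * unit_product (rev (n # ns))
      = vec_of R n * (unit_product ns * unit_product (rev ns)) * vec_of R n"
    by (simp add: mult.assoc)
  with Cons show ?case by (simp add: vec_of_square)
qed simp

text \<open>For a unit vector \<open>n\<close> the anticommutator identity says that moving
  \<open>n\<close> past a vector reflects that vector and changes the sign. The last factor of the
  list acts first, matching \<open>foldr\<close>.\<close>

lemma unit_product_conj:
  "\<forall>n\<in>set ns. n \<bullet> n = 1 \<Longrightarrow>
    unit_product ns * vec_of R x = (-1) ^ length ns *\<^sub>R (vec_of R (foldr reflection ns x) * unit_product ns)"
proof (induction ns)
  case (Cons n ns)
  have one: "vec_of R n * vec_of R y = - (vec_of R (reflection n y) * vec_of R n)" for y
  proof -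
    have "vec_of R (reflection n y) * vec_of R n
        = vec_of R y * vec_of R n - (2 * (n \<bullet> y)) *\<^sub>R (vec_of R n * vec_of R n)"
      by (simp add: reflection_def linear_diff[OF linear_vec_of] linear_scale[OF linear_vec_of] left_diff_distrib)
    also have "\<dots> = vec_of R y * vec_of R n - (2 * (n \<bullet> y)) *\<^sub>R 1"
      using Cons.prems by (simp add: vec_of_square)
    finally show ?thesis using vec_of_anticomm[of n y]
      by (metis add_diff_cancel_right' minus_diff_eq)
  qed
  have "unit_product (n # ns) * vec_of R x
      = (-1) ^ length ns *\<^sub>R (vec_of R n * vec_of R (foldr reflection ns x) * unit_product ns)"
    using Cons by (simp add: mult.assoc)
  then show ?case by (simp add: one mult.assoc)
qed simp

text \<open>Even length removes the sign and makes the main involution act trivially, which leaves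
  ordinary conjugation.\<close>

lemma chi_vec_of:
  assumes "\<forall>n\<in>set ns. n \<bullet> n = 1" "even (length ns)"
  shows "chi R (unit_product ns) (vec_of R x) = vec_of R (foldr reflection ns x)"
proof -
  let ?a = "unit_product ns" and ?b = "unit_product (rev ns)"
  have ab: "?a * ?b = 1" using unit_product_rev[OF assms(1)] .
  have "?b * ?a = 1" using unit_product_rev[of "rev ns"] assms(1) by simp
  moreover have "main_involution R ?a = ?a"
    using main_involution_even unit_product_in_wspan[of ns] assms(2) by simp
  ultimately have "chi R ?a (vec_of R x) = ?a * vec_of R x * ?b"
    using ab by (simp add: chi_def vector_part_def inv_mult_monoid)
  also have "\<dots> = vec_of R (foldr reflection ns x)"
    using unit_product_conj[OF assms(1), of x] assms(2) ab by (simp add: mult.assoc)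
  finally show ?thesis .
qed

lemma group_Spin: "group (Spin R)"
proof (rule groupI)
  show "x \<otimes>\<^bsub>Spin R\<^esub> y \<in> carrier (Spin R)" if xy: "x \<in> carrier (Spin R)" "y \<in> carrier (Spin R)" for x y
  proof -
    obtain ns ks where "x = unit_product ns" "\<forall>n\<in>set ns. n \<bullet> n = 1" "even (length ns)"
      "y = unit_product ks" "\<forall>n\<in>set ks. n \<bullet> n = 1" "even (length ks)"
      using xy unfolding carrier_Spin by blast
    then have "x * y \<in> carrier (Spin R)"
      unfolding carrier_Spin by (intro CollectI exI[of _ "ns @ ks"]) auto
    then show ?thesis by (simp add: Spin_def mult_monoid_def)
  qed
  have "1 \<in> carrier (Spin R)"
    unfolding carrier_Spin by (intro CollectI exI[of _ "[]"]) auto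
  then show "\<one>\<^bsub>Spin R\<^esub> \<in> carrier (Spin R)" by (simp add: Spin_def mult_monoid_def)
  show "\<exists>y\<in>carrier (Spin R). y \<otimes>\<^bsub>Spin R\<^esub> x = \<one>\<^bsub>Spin R\<^esub>" if x: "x \<in> carrier (Spin R)" for x
  proof -
    obtain ns where ns: "x = unit_product ns" "\<forall>n\<in>set ns. n \<bullet> n = 1" "even (length ns)"
      using x unfolding carrier_Spin by blast
    then have "unit_product (rev ns) \<in> carrier (Spin R)"
      unfolding carrier_Spin by (intro CollectI exI[of _ "rev ns"]) auto
    moreover have "unit_product (rev ns) * x = 1"
      using unit_product_rev[of "rev ns"] ns by simp
    ultimately show ?thesis
      by (intro bexI[of _ "unit_product (rev ns)"]) (simp_all add: Spin_def mult_monoid_def)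
  qed
qed (simp_all add: Spin_def mult_monoid_def mult.assoc)

lemma chi_in_carrier_SO:
  assumes "\<forall>n\<in>set ns. n \<bullet> n = 1" "even (length ns)"
  shows "chi R (unit_product ns) \<in> carrier (SO R)"
proof -
  let ?F = "foldr reflection ns" and ?T = "chi R (unit_product ns)"
  have F: "orthogonal_transformation ?F"
    using assms(1) by (rule orthogonal_transformation_foldr_reflection)
  have T: "?T (vec_of R x) = vec_of R (?F x)" for x
    using chi_vec_of[OF assms] .
  have "inj_on ?T (vector_part R)"
    using orthogonal_transformation_inj[OF F] inj_vec_of
    by (auto simp: inj_on_def vector_part_def T)
  moreover have "?T ` vector_part R = vector_part R"
  proof -
    have "?T ` vector_part R = vec_of R ` range ?F"
      by (simp add: vector_part_def image_image T)
    then show ?thesis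
      using orthogonal_transformation_surj[OF F] by (simp add: vector_part_def)
  qed
  moreover have "?T \<in> extensional (vector_part R)"
    by (simp add: chi_def)
  ultimately have "?T \<in> Bij (vector_part R)"
    by (simp add: Bij_def bij_betw_def)
  moreover have "det (matrix ?F) > 0"
    using det_foldr_reflection[OF assms(1)] assms(2) by simp
  ultimately show ?thesis
    using F T by (auto simp: SO_def intro!: exI[of _ ?F])
qed

lemma chi_image: "chi R ` carrier (Spin R) = carrier (SO R)"
proof
  show "chi R ` carrier (Spin R) \<subseteq> carrier (SO R)"
    using chi_in_carrier_SO by (auto simp: carrier_Spin)
  show "carrier (SO R) \<subseteq> chi R ` carrier (Spin R)"
  proof
    fix T assume "T \<in> carrier (SO R)"
    then obtain f where T: "T \<in> Bij (vector_part R)" "\<And>w. T (vec_of R w) = vec_of R (f w)"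
      and f: "orthogonal_transformation f" "det (matrix f) > 0"
      by (auto simp: SO_def)
    obtain ns where ns: "\<forall>n\<in>set ns. n \<bullet> n = 1" "f = foldr reflection ns"
      using orthogonal_transformation_eq_foldr_reflection[OF f(1)] by blast
    \<comment> \<open>The determinant is -1 to the number of reflections, so its positivity forces
      an even number and the product lies in \<open>Spin R\<close>.\<close>
    have even: "even (length ns)"
      using f(2) det_foldr_reflection[OF ns(1)] ns(2) by (auto simp: uminus_power_if split: if_splits)
    have "T = chi R (unit_product ns)"
    proof (rule extensionalityI)
      show "T \<in> extensional (vector_part R)" using T(1) by (rule Bij_imp_extensional)
      show "chi R (unit_product ns) \<in> extensional (vector_part R)" by (simp add: chi_def)
      show "T x = chi R (unit_product ns) x" if "x \<in> vector_part R" for x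
        using that chi_vec_of[OF ns(1) even] T(2) ns(2) by (auto simp: vector_part_def)
    qed
    then show "T \<in> chi R ` carrier (Spin R)"
      using ns(1) even by (auto simp: carrier_Spin)
  qed
qed

lemma chi_mult:
  assumes "a \<in> carrier (Spin R)" "b \<in> carrier (Spin R)"
  shows "chi R (a * b) = compose (vector_part R) (chi R a) (chi R b)"
proof (rule extensionalityI)
  obtain ns ks where ns: "a = unit_product ns" "\<forall>n\<in>set ns. n \<bullet> n = 1" "even (length ns)"
    and ks: "b = unit_product ks" "\<forall>n\<in>set ks. n \<bullet> n = 1" "even (length ks)"
    using assms unfolding carrier_Spin by blast
  have ab: "a * b = unit_product (ns @ ks)" by (simp add: ns(1) ks(1))
  show "chi R (a * b) \<in> extensional (vector_part R)" by (simp add: chi_def)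
  show "compose (vector_part R) (chi R a) (chi R b) \<in> extensional (vector_part R)"
    by (rule compose_extensional)
  fix x assume "x \<in> vector_part R"
  then obtain w where x: "x = vec_of R w" by (auto simp: vector_part_def)
  have "chi R (a * b) x = vec_of R (foldr reflection (ns @ ks) w)"
    unfolding ab x using ns ks by (intro chi_vec_of) auto
  also have "\<dots> = chi R a (chi R b x)"
    unfolding x ns(1) ks(1) by (simp add: chi_vec_of ns ks)
  finally show "chi R (a * b) x = compose (vector_part R) (chi R a) (chi R b) x"
    using \<open>x \<in> vector_part R\<close> by (simp add: compose_eq)
qed

lemma group_hom_chi: "group_hom (Spin R) (SO R) (chi R)"
proof -
  have Bij: "chi R a \<in> Bij (vector_part R)" if "a \<in> carrier (Spin R)" for a
    using that chi_image by (auto simp: SO_def)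
  have "chi R \<in> hom (Spin R) (BijGroup (vector_part R))"
    using Bij chi_mult by (auto intro!: homI simp: BijGroup_def Spin_def mult_monoid_def)
  then interpret B: group_hom "Spin R" "BijGroup (vector_part R)" "chi R"
    using group_Spin group_BijGroup by (simp add: group_hom_def group_hom_axioms_def)
  \<comment> \<open>Being the image of a homomorphism into \<open>BijGroup\<close>,
    \<open>SO R\<close> is a subgroup, so its group axioms need no separate verification.\<close>
  have SO: "SO R = (BijGroup (vector_part R)) \<lparr>carrier := chi R ` carrier (Spin R)\<rparr>"
    unfolding chi_image by (simp add: SO_def)
  have "group (SO R)"
    unfolding SO by (rule subgroup.subgroup_is_group[OF B.img_is_subgroup group_BijGroup])
  moreover have "chi R \<in> hom (Spin R) (SO R)"
    unfolding SO using B.hom_mult by (auto intro!: homI)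
  ultimately show ?thesis
    using group_Spin by (simp add: group_hom_def group_hom_axioms_def)
qed

text \<open>-1 is the product of the two unit vectors \<open>R k\<close> and \<open>- R k\<close>,
  for any index \<open>k\<close>.\<close>

lemma minus_in_Spin:
  assumes "a \<in> carrier (Spin R)"
  shows "- a \<in> carrier (Spin R)"
proof -
  fix k :: 'm
  obtain ns where ns: "a = unit_product ns" "\<forall>n\<in>set ns. n \<bullet> n = 1" "even (length ns)"
    using assms unfolding carrier_Spin by blast
  have "vec_of R (- axis k 1) = - R k"
    using linear_neg[OF linear_vec_of] vec_of_axis by metis
  then have "- a = unit_product (axis k 1 # - axis k 1 # ns)"
    using square_left[of k a] by (simp add: ns(1) vec_of_axis)
  then show ?thesis
    unfolding carrier_Spin using ns
    by (intro CollectI exI[of _ "axis k 1 # - axis k 1 # ns"]) (auto simp: inner_axis_axis)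
qed

text \<open>Both \<open>a\<close> and \<open>- a\<close> are even, hence fixed by the main
  involution, and the signs of \<open>- a\<close> and of its inverse cancel.\<close>

lemma chi_minus: "a \<in> carrier (Spin R) \<Longrightarrow> chi R (- a) = chi R a"
proof -
  assume a: "a \<in> carrier (Spin R)"
  have "main_involution R a = a \<and> (\<exists>b. a * b = 1 \<and> b * a = 1)" if Spin: "a \<in> carrier (Spin R)" for a
  proof -
    obtain ns where ns: "a = unit_product ns" "\<forall>n\<in>set ns. n \<bullet> n = 1" "even (length ns)"
      using Spin unfolding carrier_Spin by blast
    then show ?thesis
      using unit_product_rev[of ns] unit_product_rev[of "rev ns"]
        main_involution_even unit_product_in_wspan[of ns]
      by (auto intro!: exI[of _ "unit_product (rev ns)"])
  qed
  with a minus_in_Spin[OF a] obtain b where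
    b: "a * b = 1" "b * a = 1" "main_involution R a = a" "main_involution R (- a) = - a"
    by metis
  then have "inv\<^bsub>mult_monoid\<^esub> (- a) = - b" "inv\<^bsub>mult_monoid\<^esub> a = b"
    by (auto intro!: inv_mult_monoid)
  then show ?thesis by (simp add: chi_def b)
qed

lemma chi_eq_iff:
  assumes "a \<in> carrier (Spin R)" "b \<in> carrier (Spin R)"
  shows "chi R b = chi R a \<longleftrightarrow> b = a \<or> b = - a"
proof
  assume eq: "chi R b = chi R a"
  obtain ns ks where ns: "a = unit_product ns" "\<forall>n\<in>set ns. n \<bullet> n = 1" "even (length ns)"
    and ks: "b = unit_product ks" "\<forall>n\<in>set ks. n \<bullet> n = 1" "even (length ks)"
    using assms unfolding carrier_Spin by blast
  \<comment> \<open>The product over this list is the inverse of \<open>a\<close> times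
    \<open>b\<close>.\<close>
  let ?ms = "rev ns @ ks"
  have ms: "\<forall>n\<in>set ?ms. n \<bullet> n = 1" "even (length ?ms)" using ns ks by auto
  have "foldr reflection ks x = foldr reflection ns x" for x
    using chi_vec_of[OF ns(2,3), of x] chi_vec_of[OF ks(2,3), of x] eq ns(1) ks(1) inj_vec_of
    by (metis injD)
  moreover have "foldr reflection (rev ns) (foldr reflection ns x) = x" for x
    using ns(2) by (induction ns arbitrary: x) (auto simp: reflection_reflection)
  ultimately have id: "foldr reflection ?ms x = x" for x by simp
  \<comment> \<open>The induced composition of reflections is the identity, so the conjugation
    formula becomes commutation with each generator.\<close>
  have "R j * unit_product ?ms = unit_product ?ms * R j" for j
    using unit_product_conj[OF ms(1), of "axis j 1"] ms(2) unfolding id vec_of_axis by simp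
  then obtain r where r: "unit_product ?ms = r *\<^sub>R 1"
    using even_central_is_scalar[of "unit_product ?ms"] unit_product_in_wspan[of ?ms] ms(2) by auto
  have "b = a * unit_product ?ms"
    using unit_product_rev[OF ns(2)] by (simp add: ns(1) ks(1) flip: mult.assoc)
  then show "b = a \<or> b = - a"
    using scalar_product_of_unit_vectors[OF ms(1) r] r by auto
next
  show "b = a \<or> b = - a \<Longrightarrow> chi R b = chi R a"
    using chi_minus assms by auto
qed

lemma minus_neq:
  assumes "a \<in> carrier (Spin R)"
  shows "- a \<noteq> a"
proof
  assume "- a = a"
  then have "2 *\<^sub>R a = 0" by (metis add.right_inverse scaleR_2)
  then have "a = 0" by simp
  moreover obtain ns where "a = unit_product ns" "\<forall>n\<in>set ns. n \<bullet> n = 1"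
    using assms unfolding carrier_Spin by blast
  ultimately show False using unit_product_rev[of ns] by simp
qed

theorem Spin_double_cover:
  "group_hom (Spin R) (SO R) (chi R) \<and>
    chi R ` carrier (Spin R) = carrier (SO R) \<and>
    (\<forall>a\<in>carrier (Spin R). - a \<noteq> a \<and>
       {b \<in> carrier (Spin R). chi R b = chi R a} = {a, - a})"
  using group_hom_chi chi_image minus_neq chi_eq_iff minus_in_Spin by auto

end

section \<open>Directness of the parity decomposition for the given operators\<close>

theorem mainTheorem1:
  fixes ep em :: "'m::finite \<Rightarrow> 'c::complex_algebra_1"
    and R :: "'m \<Rightarrow> (int^'m, 'c) rop"
  assumes clifford: "complex_clifford_algebra ep em"
    and R_anticomm: "\<And>j k. R j * R k + R k * R j = (if j = k then 2 else 0)"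
    and R_const: "\<And>j c. apply_rop (R j) (\<lambda>_. c) = (\<lambda>_. (ep j + em j) * c)"
  shows "group_hom (Spin R) (SO R) (chi R) \<and>
    chi R ` carrier (Spin R) = carrier (SO R) \<and>
    (\<forall>a\<in>carrier (Spin R). - a \<noteq> a \<and>
       {b \<in> carrier (Spin R). chi R b = chi R a} = {a, - a})"
proof -
  interpret clifford_generators R
    by unfold_locales (rule R_anticomm)
  define e f where "e j = ep j + em j" and "f j = ep j - em j" for j
  \<comment> \<open>An operator is read off from its value on the constant function 1. The point 0
    is arbitrary, since words in the \<open>R j\<close> send constants to constants.\<close>
  define \<rho> where "\<rho> T = apply_rop T (\<lambda>_. 1) 0" for T :: "(int^'m, 'c) rop"
  have anticomms: "ep j * ep k + ep k * ep j = 0" "em j * em k + em k * em j = 0"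
    "ep j * em k + em k * ep j = (if j = k then 1 else 0)" for j k
    using clifford by (simp_all add: complex_clifford_algebra_def)
  have "f j * e k + e k * f j = (ep j * ep k + ep k * ep j) + (ep j * em k + em k * ep j)
      - (ep k * em j + em j * ep k) - (em j * em k + em k * em j)" for j k
    by (simp add: e_def f_def algebra_simps)
  then have ef: "f j * e k = - (e k * f j)" for j k
    by (simp add: anticomms eq_neg_iff_add_eq_0)
  have e_anticomm: "e j * e k + e k * e j = (ep j * ep k + ep k * ep j) + (ep j * em k + em k * ep j)
      + (ep k * em j + em j * ep k) + (em j * em k + em k * em j)" for j k
    by (simp add: e_def algebra_simps)
  then have ee: "e j * e k = - (e k * e j)" if "j \<noteq> k" for j k
    using that by (simp add: anticomms eq_neg_iff_add_eq_0)
  have "2 *\<^sub>R (e j * e j) = 2 *\<^sub>R 1" for j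
    using e_anticomm[of j j] by (simp add: anticomms scaleR_2)
  then have e2: "e j * e j = 1" for j by simp
  have "f j * f j + f j * f j = (ep j * ep j + ep j * ep j) - (ep j * em j + em j * ep j)
      - (ep j * em j + em j * ep j) + (em j * em j + em j * em j)" for j
    by (simp add: f_def algebra_simps)
  then have "2 *\<^sub>R (f j * f j) = 2 *\<^sub>R (- 1)" for j
    by (simp add: anticomms scaleR_2)
  then have f2: "f j * f j = -1" for j by (simp only: scaleR_cancel_left) simp
  have rho_R: "\<rho> (R j) = e j" for j
    by (simp add: \<rho>_def R_const e_def)
  have "\<exists>d. apply_rop x (\<lambda>_. 1) = (\<lambda>_. d)" if "x \<in> wspan UNIV p" for x p
    using that
  proof (induction rule: wspan_induct)
    case zero
    then show ?case by (auto simp: zero_rop.rep_eq)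
  next
    case (step c js y)
    have "\<exists>d. apply_rop (word js) (\<lambda>_. 1) = (\<lambda>_. d)"
      by (induction js) (auto simp: one_rop.rep_eq times_rop.rep_eq R_const)
    with step show ?case
      by (auto simp: plus_rop.rep_eq scaleR_rop.rep_eq)
  qed
  then have const: "apply_rop x (\<lambda>_. 1) = (\<lambda>_. \<rho> x)" if "x \<in> wspan UNIV p" for x p
    using that by (fastforce simp: \<rho>_def)
  \<comment> \<open>\<open>R_const\<close> describes \<open>R j\<close> only on constants; this
    suffices because \<open>x\<close> maps 1 to a constant function.\<close>
  have rho_mult: "\<rho> (R j * x) = \<rho> (R j) * \<rho> x" if "x \<in> wspan UNIV p" for j x p
  proof -
    have "\<rho> (R j * x) = apply_rop (R j) (apply_rop x (\<lambda>_. 1)) 0"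
      by (simp add: \<rho>_def times_rop.rep_eq)
    also have "\<dots> = e j * \<rho> x"
      unfolding const[OF that] R_const e_def ..
    finally show ?thesis by (simp add: rho_R)
  qed
  \<comment> \<open>Anticommutation of \<open>e j\<close> with \<open>f j\<close> gives one sign and
    the square of \<open>f j\<close> another, so \<open>e j * f j\<close> is its own
    inverse.\<close>
  have uu: "(e j * f j) * (e j * f j) = 1" for j
  proof -
    have "(e j * f j) * (e j * f j) = e j * (f j * e j) * f j" by (simp add: mult.assoc)
    also have "\<dots> = - ((e j * e j) * (f j * f j))" unfolding ef by (simp add: mult.assoc)
    finally show ?thesis by (simp add: e2 f2)
  qed
  have us: "(e j * f j) * e j = - (e j * (e j * f j))" for j
    using ef[of j j] by (simp add: mult.assoc)
  \<comment> \<open>\<open>e k\<close> anticommutes with both factors, so the two signs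
    cancel.\<close>
  have uo: "(e j * f j) * e k = e k * (e j * f j)" if "j \<noteq> k" for j k
  proof -
    have "(e j * f j) * e k = - (e j * e k) * f j" by (simp add: mult.assoc ef)
    then show ?thesis by (simp add: ee[OF that] mult.assoc)
  qed
  interpret graded_clifford_generators R
  proof
    fix a b assume ab: "a \<in> wspan UNIV True" "b \<in> wspan UNIV False" "a + b = 0"
    show "a = 0"
    proof (rule parity_direct_if_hom[of \<rho> "\<lambda>j. e j * f j", OF _ _ _ rho_mult _ _ _ ab])
    qed (simp_all only: rho_R uu us, simp_all add: uo \<rho>_def plus_rop.rep_eq scaleR_rop.rep_eq one_rop.rep_eq)
  qed
  show ?thesis by (rule Spin_double_cover)
qed

end
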